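(* Let $m<n$ and $\lambda>0$. (SG) Let $A\in\mathbb{R}^{n\times m}$ have maximal rank $m$ and let $B\in\mathbb{R}^{n\times n}$. Then $(A,B)$ is an equilibrium of the SG algorithm if and only if $$([xx^T]S+\lambda\,\mathrm{Id})(S[xx^T]+\lambda\,\mathrm{Id})=[xy^T]\,S\,[yx^T],\quad\text{where } S=A^TA,$$ and $$B=A[yx^T]A^TW^{-1},\quad\text{where } W=A[xx^T]A^T+\lambda\,\mathrm{Id}.$$ (EMA) Let $A\in\mathbb{R}^{n\times m}$ have maximal rank $m$, $B\in\mathbb{R}^{n\times n}$ and $C\in\mathbb{R}^{n\times m}$. Then $(A,B,C)$ is an equilibrium of the EMA algorithm if and only if $A$ and $B$ satisfy the two equations above and $C=A$. In both cases, the pairs $(A,B)$ associated with these equilibria also satisfy $B^TB=AA^T$.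
   Context: Let $(x,y)$ be a random pair in $\mathbb{R}^m\times\mathbb{R}^m$ with finite second moments, and write $[xx^T]=\mathbb{E}[xx^T]$, $[yx^T]=\mathbb{E}[yx^T]$, $[xy^T]=[yx^T]^T$. For $A,C\in\mathbb{R}^{n\times m}$ and $B\in\mathbb{R}^{n\times n}$ put $R(A,B,C)=BA[xx^T]-C[yx^T]$. The (continuous) dynamical system of the EMA algorithm in the linear case (encoder $x\mapsto Ax$, target encoder $y\mapsto Cy$, predictor $z\mapsto Bz$), with a constant $\alpha\neq 1$, is $$\dot A=-(B^TR(A,B,C)+\lambda A),\quad \dot B=-(R(A,B,C)A^T+\lambda B),\quad \dot C=(1-\alpha)(A-C).$$ The dynamical system of the SG algorithm is obtained by setting $C=A$ and dropping the third equation: $$\dot A=-(B^TR(A,B,A)+\lambda A),\quad \dot B=-(R(A,B,A)A^T+\lambda B).$$ An equilibrium is a point where the right-hand side of the system vanishes. *)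

theory Defs
  imports "HOL-Probability.Probability"
begin

text \<open>The matrix \<open>[uv\<^sup>T] = \<E>[uv\<^sup>T]\<close>, as a matrix-valued Bochner integral.\<close>

definition cross_moment ::
    "'a measure \<Rightarrow> ('a \<Rightarrow> real^'m) \<Rightarrow> ('a \<Rightarrow> real^'k) \<Rightarrow> real^'k^'m" where
  "cross_moment M u v = (\<integral>\<omega>. (\<chi> i j. u \<omega> $ i * v \<omega> $ j) \<partial>M)"

text \<open>A matrix in \<open>\<real>\<^bsup>n\<times>m\<^esup>\<close> has type \<^typ>\<open>real^'m^'n\<close>.\<close>

definition residual ::
    "'a measure \<Rightarrow> ('a \<Rightarrow> real^'m) \<Rightarrow> ('a \<Rightarrow> real^'m) \<Rightarrow>
     real^'m^'n \<Rightarrow> real^'n^'n \<Rightarrow> real^'m^'n \<Rightarrow> real^'m^'n" where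
  "residual M x y A B C = B ** A ** cross_moment M x x - C ** cross_moment M y x"

definition ema_rhs ::
    "'a measure \<Rightarrow> ('a \<Rightarrow> real^'m) \<Rightarrow> ('a \<Rightarrow> real^'m) \<Rightarrow> real \<Rightarrow> real \<Rightarrow>
     (real^'m^'n) \<times> (real^'n^'n) \<times> (real^'m^'n) \<Rightarrow> (real^'m^'n) \<times> (real^'n^'n) \<times> (real^'m^'n)" where
  "ema_rhs M x y lam \<alpha> = (\<lambda>(A, B, C).
     (- (transpose B ** residual M x y A B C + lam *\<^sub>R A),
      - (residual M x y A B C ** transpose A + lam *\<^sub>R B),
      (1 - \<alpha>) *\<^sub>R (A - C)))"

definition sg_rhs ::
    "'a measure \<Rightarrow> ('a \<Rightarrow> real^'m) \<Rightarrow> ('a \<Rightarrow> real^'m) \<Rightarrow> real \<Rightarrow>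
     (real^'m^'n) \<times> (real^'n^'n) \<Rightarrow> (real^'m^'n) \<times> (real^'n^'n)" where
  "sg_rhs M x y lam = (\<lambda>(A, B).
     (- (transpose B ** residual M x y A B A + lam *\<^sub>R A),
      - (residual M x y A B A ** transpose A + lam *\<^sub>R B)))"

definition equilibrium :: "('s::real_vector \<Rightarrow> 's) \<Rightarrow> 's \<Rightarrow> bool" where
  "equilibrium F p \<longleftrightarrow> F p = 0"

lemma integrable_outer:
  fixes u :: "'a \<Rightarrow> real^'m" and v :: "'a \<Rightarrow> real^'k"
  assumes [measurable]: "u \<in> borel_measurable M" "v \<in> borel_measurable M"
    and "integrable M (\<lambda>\<omega>. (norm (u \<omega>))\<^sup>2)" "integrable M (\<lambda>\<omega>. (norm (v \<omega>))\<^sup>2)"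
  shows "integrable M (\<lambda>\<omega>. (\<chi> i j. u \<omega> $ i * v \<omega> $ j) :: real^'k^'m)"
proof -
  have c: "integrable M (\<lambda>\<omega>. u \<omega> $ i * v \<omega> $ j)" for i j
  proof (rule Bochner_Integration.integrable_bound)
    show "integrable M (\<lambda>\<omega>. (norm (u \<omega>))\<^sup>2 + (norm (v \<omega>))\<^sup>2)"
      using assms by auto
    have "(\<lambda>\<omega>. u \<omega> \<bullet> axis i 1 * (v \<omega> \<bullet> axis j 1)) \<in> borel_measurable M"
      by measurable
    then show "(\<lambda>\<omega>. u \<omega> $ i * v \<omega> $ j) \<in> borel_measurable M"
      by (simp add: inner_axis)
    have "\<bar>u \<omega> $ i * v \<omega> $ j\<bar> \<le> (norm (u \<omega>))\<^sup>2 + (norm (v \<omega>))\<^sup>2" for \<omega>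
    proof -
      have "\<bar>u \<omega> $ i * v \<omega> $ j\<bar> \<le> norm (u \<omega>) * norm (v \<omega>)"
        unfolding abs_mult by (intro mult_mono component_le_norm_cart) auto
      also have "\<dots> \<le> (norm (u \<omega>))\<^sup>2 + (norm (v \<omega>))\<^sup>2"
        using sum_squares_bound[of "norm (u \<omega>)" "norm (v \<omega>)"]
          mult_nonneg_nonneg[OF norm_ge_zero[of "u \<omega>"] norm_ge_zero[of "v \<omega>"]]
        unfolding mult.assoc by linarith
      finally show ?thesis .
    qed
    then show "AE \<omega> in M. norm (u \<omega> $ i * v \<omega> $ j) \<le> norm ((norm (u \<omega>))\<^sup>2 + (norm (v \<omega>))\<^sup>2)"
      by simp
  qed
  have "(\<lambda>\<omega>. (\<chi> i j. u \<omega> $ i * v \<omega> $ j) :: real^'k^'m) =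
      (\<lambda>\<omega>. \<Sum>i\<in>UNIV. \<Sum>j\<in>UNIV. (u \<omega> $ i * v \<omega> $ j) *\<^sub>R axis i (axis j 1))"
  proof (intro ext, unfold vec_eq_iff, intro allI)
    fix \<omega> i j
    have ax: "(axis k (axis l 1) :: real^'k^'m) $ i $ j = (if i = k then if j = l then 1 else 0 else 0)" for k l
      by (simp add: axis_def)
    have "(\<Sum>l\<in>UNIV. u \<omega> $ k * v \<omega> $ l * (if i = k then if j = l then 1 else 0 else 0)) =
        (if i = k then u \<omega> $ k * v \<omega> $ j else 0)" for k
      by (cases "i = k") (simp_all add: mult.assoc flip: sum_distrib_left, simp add: if_distrib cong: if_cong)
    then show "((\<chi> i j. u \<omega> $ i * v \<omega> $ j) :: real^'k^'m) $ i $ j =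
        (\<Sum>k\<in>UNIV. \<Sum>l\<in>UNIV. (u \<omega> $ k * v \<omega> $ l) *\<^sub>R axis k (axis l 1)) $ i $ j"
      unfolding sum_component vector_scaleR_component ax real_scaleR_def by simp
  qed
  moreover have "integrable M (\<lambda>\<omega>. \<Sum>i\<in>UNIV. \<Sum>j\<in>UNIV. (u \<omega> $ i * v \<omega> $ j) *\<^sub>R (axis i (axis j 1) :: real^'k^'m))"
    by (intro Bochner_Integration.integrable_sum integrable_scaleR_left c)
  ultimately show ?thesis by simp
qed

lemma cross_moment_nth:
  fixes u :: "'a \<Rightarrow> real^'m" and v :: "'a \<Rightarrow> real^'k"
  assumes "u \<in> borel_measurable M" "v \<in> borel_measurable M"
    and "integrable M (\<lambda>\<omega>. (norm (u \<omega>))\<^sup>2)" "integrable M (\<lambda>\<omega>. (norm (v \<omega>))\<^sup>2)"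
  shows "cross_moment M u v $ i $ j = (\<integral>\<omega>. u \<omega> $ i * v \<omega> $ j \<partial>M)"
proof -
  have "bounded_linear (\<lambda>z::real^'k^'m. z $ i $ j)"
    using bounded_linear_compose[OF bounded_linear_vec_nth bounded_linear_vec_nth] .
  from integral_bounded_linear[OF this integrable_outer[OF assms]]
  show ?thesis unfolding cross_moment_def by simp
qed

lemma transpose_cross_moment:
  fixes u :: "'a \<Rightarrow> real^'m" and v :: "'a \<Rightarrow> real^'k"
  assumes "u \<in> borel_measurable M" "v \<in> borel_measurable M"
    and "integrable M (\<lambda>\<omega>. (norm (u \<omega>))\<^sup>2)" "integrable M (\<lambda>\<omega>. (norm (v \<omega>))\<^sup>2)"
  shows "transpose (cross_moment M u v) = cross_moment M v u"
  using assms by (simp add: vec_eq_iff transpose_def cross_moment_nth mult.commute)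

text \<open>The library's \<^const>\<open>matrix_inv\<close> is unspecified on singular matrices; this lemma
  shows that \<open>W\<close> is never singular.\<close>

lemma invertible_W:
  fixes x :: "'a \<Rightarrow> real^'m" and A :: "real^'m^'n"
  assumes "x \<in> borel_measurable M" "integrable M (\<lambda>\<omega>. (norm (x \<omega>))\<^sup>2)" "lam > 0"
  shows "invertible (A ** cross_moment M x x ** transpose A + lam *\<^sub>R mat 1)"
proof -
  let ?X = "cross_moment M x x"
  have psd: "w \<bullet> (?X *v w) \<ge> 0" for w
  proof -
    have bl: "bounded_linear (\<lambda>Z::real^'m^'m. w \<bullet> (Z *v w))"
      unfolding linear_conv_bounded_linear[symmetric]
      by (rule linearI)
        (simp_all add: matrix_vector_mult_add_rdistrib inner_add_right scaleR_matrix_vector_assoc[symmetric])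
    have "w \<bullet> (?X *v w) = (\<integral>\<omega>. w \<bullet> ((\<chi> i j. x \<omega> $ i * x \<omega> $ j) *v w) \<partial>M)"
      unfolding cross_moment_def
      using integral_bounded_linear[OF bl integrable_outer[OF assms(1,1,2,2)]] by simp
    also have "\<dots> = (\<integral>\<omega>. (w \<bullet> x \<omega>)\<^sup>2 \<partial>M)"
      by (intro Bochner_Integration.integral_cong refl)
        (simp add: inner_vec_def matrix_vector_mult_def power2_eq_square sum_product
          sum_distrib_left algebra_simps)
    finally show ?thesis by simp
  qed
  have "v = 0" if "(A ** ?X ** transpose A + lam *\<^sub>R mat 1) *v v = 0" for v
  proof -
    have "v \<bullet> ((A ** ?X ** transpose A + lam *\<^sub>R mat 1) *v v) =
        (transpose A *v v) \<bullet> (?X *v (transpose A *v v)) + lam * (v \<bullet> v)"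
      by (simp add: matrix_vector_mult_add_rdistrib inner_add_right dot_lmul_matrix
          scaleR_matrix_vector_assoc[symmetric] matrix_vector_mul_assoc[symmetric])
    with that psd[of "transpose A *v v"] have "lam * (v \<bullet> v) \<le> 0"
      by simp
    with \<open>lam > 0\<close> have "v \<bullet> v \<le> 0"
      by (simp add: mult_le_0_iff)
    then show ?thesis
      using inner_ge_zero[of v] inner_eq_zero_iff[of v] by linarith
  qed
  then show ?thesis
    by (simp add: invertible_left_inverse matrix_left_invertible_ker)
qed

end

theory Submission
  imports Defs
begin

text \<open>Write \<open>R = BAX - AY\<close>. The second equation says \<open>BW = AYA\<^sup>T\<close>. Multiplying the first one by \<open>A\<^sup>T\<close> on
  the right loses nothing, because \<open>A\<close> has a left inverse, and \<open>RA\<^sup>T = -\<lambda>B\<close> turns the product into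
  \<open>B\<^sup>TB = AA\<^sup>T\<close>. Conjugating this with the invertible symmetric matrix \<open>W\<close> and using
  \<open>WA = A(XS + \<lambda>)\<close>, both sides become of the form \<open>AZA\<^sup>T\<close>, where \<open>A\<close> and \<open>A\<^sup>T\<close> can be cancelled.\<close>

lemma matrix_add_rdistrib:
  fixes A B :: "real^'m^'n"
  shows "(A + B) ** C = A ** C + B ** C"
  by (simp add: vec_eq_iff matrix_matrix_mult_def distrib_right sum.distrib)

lemma matrix_sub_rdistrib:
  fixes A B :: "real^'m^'n"
  shows "(A - B) ** C = A ** C - B ** C"
  by (simp add: vec_eq_iff matrix_matrix_mult_def left_diff_distrib sum_subtractf)

lemma transpose_add:
  fixes A B :: "real^'m^'n"
  shows "transpose (A + B) = transpose A + transpose B"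
  by (simp add: vec_eq_iff transpose_def)

lemma matrix_mul_left_cancel:
  fixes A :: "real^'k^'n" and Z Z' :: "real^'m^'k"
  assumes "L ** A = mat 1"
  shows "A ** Z = A ** Z' \<longleftrightarrow> Z = Z'"
  by (metis assms matrix_mul_assoc matrix_mul_lid)

lemma matrix_mul_right_cancel:
  fixes A :: "real^'k^'n" and Z Z' :: "real^'n^'m"
  assumes "A ** P = mat 1"
  shows "Z ** A = Z' ** A \<longleftrightarrow> Z = Z'"
  by (metis assms matrix_mul_assoc matrix_mul_rid)

text \<open>Transposing a left inverse of \<open>A\<close> gives a right inverse of
  \<open>transpose A\<close>.\<close>

lemma matrix_mul_transpose_right_cancel:
  fixes A :: "real^'k^'n" and Z Z' :: "real^'k^'m"
  assumes "L ** A = mat 1"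
  shows "Z ** transpose A = Z' ** transpose A \<longleftrightarrow> Z = Z'"
proof (rule matrix_mul_right_cancel)
  show "transpose A ** transpose L = mat 1"
    by (metis assms matrix_transpose_mul transpose_mat)
qed

lemma matrix_inv_inverse:
  fixes W :: "real^'n^'n"
  assumes "invertible W"
  shows "W ** matrix_inv W = mat 1" "matrix_inv W ** W = mat 1"
  using assms unfolding invertible_def matrix_inv_def by (metis (mono_tags, lifting) someI_ex)+

text \<open>Clears the inverse from the formula for \<open>B\<close>, so that the rest of the
  argument only handles products with \<open>W\<close>.\<close>

lemma eq_matrix_mul_inv_iff:
  fixes W :: "real^'n^'n" and B K :: "real^'n^'m"
  assumes "invertible W"
  shows "B = K ** matrix_inv W \<longleftrightarrow> B ** W = K"
  by (metis assms matrix_inv_inverse matrix_mul_assoc matrix_mul_rid)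

lemma second_equation_iff:
  fixes A :: "real^'m^'n" and B :: "real^'n^'n" and X Y :: "real^'m^'m"
  shows "(B ** A ** X - A ** Y) ** transpose A + c *\<^sub>R B = 0 \<longleftrightarrow>
    B ** (A ** X ** transpose A + c *\<^sub>R mat 1) = A ** Y ** transpose A"
  by (simp add: matrix_sub_rdistrib matrix_add_ldistrib matrix_scalar_ac scalar_matrix_assoc[symmetric] matrix_mul_assoc
      algebra_simps)

text \<open>The second equation determines \<open>R\<close> only after multiplication by
  \<open>transpose A\<close>, which is why the first one is multiplied by it too. Then
  \<open>c\<close> is a common factor.\<close>

lemma first_equation_iff:
  fixes A R :: "real^'m^'n" and B :: "real^'n^'n"
  assumes L: "L ** A = mat 1" and c: "c \<noteq> 0"
    and R: "R ** transpose A + c *\<^sub>R B = 0"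
  shows "transpose B ** R + c *\<^sub>R A = 0 \<longleftrightarrow> transpose B ** B = A ** transpose A"
proof -
  have RA: "R ** transpose A = (- c) *\<^sub>R B"
    using R by (simp add: eq_neg_iff_add_eq_0)
  \<comment> \<open>An equivalence, since \<open>transpose A\<close> has a right inverse.\<close>
  have "transpose B ** R + c *\<^sub>R A = 0 \<longleftrightarrow>
      (transpose B ** R + c *\<^sub>R A) ** transpose A = 0 ** transpose A"
    using matrix_mul_transpose_right_cancel[OF L] by blast
  also have "\<dots> \<longleftrightarrow> transpose B ** (R ** transpose A) + c *\<^sub>R (A ** transpose A) = 0"
    by (simp add: matrix_add_rdistrib scalar_matrix_assoc[symmetric] matrix_mul_assoc)
  also have "\<dots> \<longleftrightarrow> c *\<^sub>R (A ** transpose A) = c *\<^sub>R (transpose B ** B)"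
    unfolding RA matrix_scalar_ac scalar_matrix_assoc[symmetric] by (simp add: algebra_simps)
  also have "\<dots> \<longleftrightarrow> transpose B ** B = A ** transpose A"
    using c by auto
  finally show ?thesis .
qed

text \<open>\<open>B\<close> is known only through \<open>B ** W\<close>, so the Gram identity is
  multiplied by \<open>W\<close> on both sides; symmetry of \<open>W\<close> makes the left factor
  \<open>transpose (B ** W)\<close>.\<close>

lemma gram_eq_iff:
  fixes A :: "real^'m^'n" and B :: "real^'n^'n" and X Y :: "real^'m^'m" and c :: real
  defines "W \<equiv> A ** X ** transpose A + c *\<^sub>R mat 1" and "S \<equiv> transpose A ** A"
  assumes L: "L ** A = mat 1" and X: "transpose X = X" and W: "invertible W"
    and BW: "B ** W = A ** Y ** transpose A"
  shows "transpose B ** B = A ** transpose A \<longleftrightarrow>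
    (X ** S + c *\<^sub>R mat 1) ** (S ** X + c *\<^sub>R mat 1) = transpose Y ** S ** Y"
proof -
  have Wt: "transpose W = W"
    by (simp add: W_def transpose_add transpose_scalar matrix_transpose_mul X matrix_mul_assoc)
  \<comment> \<open>Push-through identities: \<open>A\<close> moves to the left past
    \<open>W\<close>, and below \<open>transpose A\<close> moves to the right, leaving a factor of
    the small size m by m.\<close>
  have WA: "W ** A = A ** (X ** S + c *\<^sub>R mat 1)"
    by (simp add: W_def S_def matrix_add_rdistrib matrix_add_ldistrib scalar_matrix_assoc[symmetric]
        matrix_scalar_ac matrix_mul_assoc)
  have AW: "transpose A ** W = (S ** X + c *\<^sub>R mat 1) ** transpose A"
    by (simp add: W_def S_def matrix_add_rdistrib matrix_add_ldistrib scalar_matrix_assoc[symmetric]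
        matrix_scalar_ac matrix_mul_assoc)
  have "transpose B ** B = A ** transpose A \<longleftrightarrow>
      W ** (transpose B ** B) ** W = W ** (A ** transpose A) ** W"
    using matrix_mul_left_cancel[OF matrix_inv_inverse(2)[OF W]]
      matrix_mul_right_cancel[OF matrix_inv_inverse(1)[OF W]] by blast
  also have "W ** (transpose B ** B) ** W = transpose (B ** W) ** (B ** W)"
    by (simp add: matrix_transpose_mul Wt matrix_mul_assoc)
  also have "\<dots> = A ** (transpose Y ** S ** Y) ** transpose A"
    by (simp add: BW S_def matrix_transpose_mul matrix_mul_assoc)
  \<comment> \<open>Regrouped so that both push-through identities apply.\<close>
  also have "W ** (A ** transpose A) ** W = (W ** A) ** (transpose A ** W)"
    by (simp add: matrix_mul_assoc)
  also have "\<dots> = A ** ((X ** S + c *\<^sub>R mat 1) ** (S ** X + c *\<^sub>R mat 1)) ** transpose A"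
    by (simp add: WA AW matrix_mul_assoc)
  finally show ?thesis
    unfolding matrix_mul_transpose_right_cancel[OF L] matrix_mul_left_cancel[OF L] by auto
qed

lemma sg_equilibrium_iff:
  "equilibrium (sg_rhs M x y c) (A, B) \<longleftrightarrow>
    transpose B ** residual M x y A B A + c *\<^sub>R A = 0 \<and>
    residual M x y A B A ** transpose A + c *\<^sub>R B = 0"
  \<comment> \<open>The minus sign must stay outside the sum to be dropped as a whole.\<close>
  by (simp add: equilibrium_def sg_rhs_def zero_prod_def neg_equal_0_iff_equal del: minus_add_distrib)

text \<open>As 1 - \<alpha> is nonzero, the third equation forces \<open>C = A\<close>, and then the
  other two are those of SG.\<close>

lemma ema_equilibrium_iff:
  assumes "\<alpha> \<noteq> 1"
  shows "equilibrium (ema_rhs M x y c \<alpha>) (A, B, C) \<longleftrightarrow> equilibrium (sg_rhs M x y c) (A, B) \<and> C = A"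
  using assms by (auto simp add: equilibrium_def sg_rhs_def ema_rhs_def zero_prod_def)

theorem proposition4p5:
  fixes M :: "'a measure"
    and x y :: "'a \<Rightarrow> real^'m"
    and lam \<alpha> :: real
  assumes "prob_space M"
    and "x \<in> borel_measurable M" and "y \<in> borel_measurable M"
    and "integrable M (\<lambda>\<omega>. (norm (x \<omega>))\<^sup>2)" and "integrable M (\<lambda>\<omega>. (norm (y \<omega>))\<^sup>2)"
    and "\<alpha> \<noteq> 1"
    and "CARD('m) < CARD('n)"
    and "lam > 0"
  shows
    "(\<forall>(A :: real^'m^'n) (B :: real^'n^'n). rank A = CARD('m) \<longrightarrow>
        (equilibrium (sg_rhs M x y lam) (A, B) \<longleftrightarrow>
          (let S = transpose A ** A;
               W = A ** cross_moment M x x ** transpose A + lam *\<^sub>R mat 1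
           in (cross_moment M x x ** S + lam *\<^sub>R mat 1) ** (S ** cross_moment M x x + lam *\<^sub>R mat 1)
                = cross_moment M x y ** S ** cross_moment M y x \<and>
              B = A ** cross_moment M y x ** transpose A ** matrix_inv W))) \<and>
     (\<forall>(A :: real^'m^'n) (B :: real^'n^'n) (C :: real^'m^'n). rank A = CARD('m) \<longrightarrow>
        (equilibrium (ema_rhs M x y lam \<alpha>) (A, B, C) \<longleftrightarrow>
          (let S = transpose A ** A;
               W = A ** cross_moment M x x ** transpose A + lam *\<^sub>R mat 1
           in (cross_moment M x x ** S + lam *\<^sub>R mat 1) ** (S ** cross_moment M x x + lam *\<^sub>R mat 1)
                = cross_moment M x y ** S ** cross_moment M y x \<and>
              B = A ** cross_moment M y x ** transpose A ** matrix_inv W) \<and> C = A)) \<and>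
     (\<forall>(A :: real^'m^'n) (B :: real^'n^'n). rank A = CARD('m) \<longrightarrow>
        equilibrium (sg_rhs M x y lam) (A, B) \<longrightarrow> transpose B ** B = A ** transpose A) \<and>
     (\<forall>(A :: real^'m^'n) (B :: real^'n^'n) (C :: real^'m^'n). rank A = CARD('m) \<longrightarrow>
        equilibrium (ema_rhs M x y lam \<alpha>) (A, B, C) \<longrightarrow> transpose B ** B = A ** transpose A)"
proof -
  let ?X = "cross_moment M x x" and ?Y = "cross_moment M y x"
  have X: "transpose ?X = ?X" and Y: "transpose ?Y = cross_moment M x y"
    using assms by (simp_all add: transpose_cross_moment)
  have equation: "equilibrium (sg_rhs M x y lam) (A, B) \<longleftrightarrow>
      (?X ** (transpose A ** A) + lam *\<^sub>R mat 1) ** (transpose A ** A ** ?X + lam *\<^sub>R mat 1)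
        = cross_moment M x y ** (transpose A ** A) ** ?Y \<and>
      B = A ** ?Y ** transpose A ** matrix_inv (A ** ?X ** transpose A + lam *\<^sub>R mat 1)" (is ?equation)
    and gram: "equilibrium (sg_rhs M x y lam) (A, B) \<Longrightarrow> transpose B ** B = A ** transpose A"
    if "rank A = CARD('m)" for A :: "real^'m^'n" and B :: "real^'n^'n"
  proof -
    \<comment> \<open>Rank m means that \<open>A\<close> is injective, hence left
      invertible.\<close>
    obtain L where L: "L ** A = mat 1"
      using \<open>rank A = CARD('m)\<close>
      unfolding full_rank_injective matrix_left_invertible_injective[symmetric] by blast
    have W: "invertible (A ** ?X ** transpose A + lam *\<^sub>R mat 1)"
      using assms by (intro invertible_W)
    let ?BW = "B ** (A ** ?X ** transpose A + lam *\<^sub>R mat 1) = A ** ?Y ** transpose A"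
    \<comment> \<open>\<open>?BW\<close> is the second equation; once it holds, the first one is the
      Gram identity.\<close>
    have sg: "equilibrium (sg_rhs M x y lam) (A, B) \<longleftrightarrow> transpose B ** B = A ** transpose A \<and> ?BW"
      using first_equation_iff[OF L, of lam "residual M x y A B A" B] \<open>lam > 0\<close>
        second_equation_iff[of B A ?X ?Y lam]
      unfolding sg_equilibrium_iff residual_def by auto
    show ?equation
      \<comment> \<open>Both sides now contain \<open>?BW\<close>, under which the Gram identity and
        the equation for \<open>transpose A ** A\<close> are equivalent.\<close>
      unfolding sg eq_matrix_mul_inv_iff[OF W]
      using gram_eq_iff[OF L X W, of B ?Y] unfolding Y by blast
    show "transpose B ** B = A ** transpose A" if "equilibrium (sg_rhs M x y lam) (A, B)"
      using that sg by blast
  qed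
  show ?thesis
    using equation gram ema_equilibrium_iff[OF \<open>\<alpha> \<noteq> 1\<close>] unfolding Let_def by blast
qed

end
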